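(* Let $p_1,p_2,p_3\in\{3,4,5,\dots\}\cup\{\infty\}$, and let $$t_A=\sqrt{\frac{1+c_A}{1-c_A}},\qquad c_A=\frac{4r_1^2r_2^2+r_3^2-1}{4r_1r_2r_3},\qquad r_k=\cos(\pi/p_k)$$ (with $t_A=+\infty$ if $c_A\ge1$ and $t_A=-\infty$ if $c_A<-1$). The $(p_1,p_2,p_3)$-triangle group representation with parameter $t\in(-t_\infty,t_\infty)$ satisfying $|t|>t_A$ is not a discrete embedding, because the element $w_A=\iota_3\iota_2\iota_3\iota_1$ is regular elliptic.
   Context: $\mathbb C^{2,1}$ is $\mathbb C^3$ with the Hermitian form $\langle z,w\rangle=z_1\bar w_1+z_2\bar w_2-z_3\bar w_3$. The complex hyperbolic plane $H^2_{\mathbb C}$ is the projectivisation of the set of vectors with $\langle z,z\rangle<0$; its ideal boundary is the projectivisation of the set of nonzero null vectors; its holomorphic isometry group is $\mathrm{PU}(2,1)$. A complex geodesic $C$ is the projectivisation (intersected with $H^2_{\mathbb C}$) of the orthogonal complement of a vector $c$ with $\langle c,c\rangle>0$; $c$ is called a polar vector of $C$, normalised if $\langle c,c\rangle=1$. Two complex geodesics with normalised polar vectors $c,c'$ meet in $H^2_{\mathbb C}$ at angle $\varphi\in(0,\pi/2]$ iff $|\langle c,c'\rangle|=\cos\varphi<1$; distinct complex geodesics have closures meeting in one point of the ideal boundary ("angle $0$") iff $|\langle c,c'\rangle|=1$. A complex hyperbolic triangle is a triple $(C_1,C_2,C_3)$ of complex geodesics, with normalised polar vectors $c_k$ (indices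 mod 3) and $r_k=|\langle c_{k-1},c_{k+1}\rangle|$. It is a $(p_1,p_2,p_3)$-triangle if $C_{k-1}$ and $C_{k+1}$ meet at angle $\pi/p_k$ for each $k$ (with $\pi/\infty=0$), so $r_k=\cos(\pi/p_k)$. Its angular invariant is $\alpha=\arg\left(\prod_{k=1}^3\langle c_{k-1},c_{k+1}\rangle\right)$. The complex reflection in $C_k$ is $\iota_k(z)=-z+2\langle z,c_k\rangle c_k$. The $(p_1,p_2,p_3)$-triangle group representation is the homomorphism $$\Gamma(p_1,p_2,p_3)=\langle\gamma_1,\gamma_2,\gamma_3\mid\gamma_k^2=(\gamma_{k-1}\gamma_{k+1})^{p_k}=1,\ k=1,2,3\rangle\to\mathrm{PU}(2,1),\quad\gamma_k\mapsto\iota_k$$ (the relation $(\gamma_{k-1}\gamma_{k+1})^{p_k}=1$ being omitted if $p_k=\infty$). It is a discrete embedding if it is injective with discrete image. These representations are parameterised by $t=\cot(\alpha/2)$; such a (nondegenerate) triangle exists for $t\in(-t_\infty,t_\infty)$, where $t_\infty=\sqrt{(1+c_\infty)/(1-c_\infty)}$ and $c_\infty=\frac{r_1^2+r_2^2+r_3^2-1}{2r_1r_2r_3}$ (with $t_\infty=+\infty$ if $c_\infty\ge1$ and $t_\infty=-\infty$ if $c_\infty<-1$). An isometry in $\mathrm{PU}(2,1)$ is elliptic if it has a fixed point in $H^2_{\mathbb C}$, and regular elliptic if in addition all eigenvalues of a representing matrix are distinct. *)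

theory Defs
  imports "HOL-Analysis.Analysis" "HOL-Algebra.Coset" "HOL-Library.Extended_Nat"
begin

text \<open>
  The index type \<^typ>\<open>3\<close> is the ring of integers modulo 3, so \<open>k - 1\<close> and \<open>k + 1\<close> are
  cyclic, and the index \<open>3\<close> is the element \<open>0\<close>.
\<close>

subsection \<open>The complex hyperbolic plane\<close>

definition herm :: "complex^3 \<Rightarrow> complex^3 \<Rightarrow> complex" where
  "herm z w = z$1 * cnj (w$1) + z$2 * cnj (w$2) - z$3 * cnj (w$3)"

text \<open>
  A point of the projective plane is represented by the corresponding complex line in
  \<^typ>\<open>complex^3\<close>. The number \<open>herm z z\<close> is always real.
\<close>

definition proj_point :: "complex^3 \<Rightarrow> (complex^3) set" where
  "proj_point z = range (\<lambda>u. u *s z)"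

definition CH2 :: "(complex^3) set set" where
  "CH2 = proj_point ` {z. Re (herm z z) < 0}"

definition complex_geodesic :: "complex^3 \<Rightarrow> (complex^3) set set" where
  "complex_geodesic c = {L \<in> CH2. \<forall>z\<in>L. herm z c = 0}"

definition normalised_polar :: "complex^3 \<Rightarrow> bool" where
  "normalised_polar c \<longleftrightarrow> herm c c = 1"

text \<open>
  The angle, in \<open>[0, \<pi>/2]\<close>, of two complex geodesics given by normalised polar vectors. The
  geodesics meet in \<^const>\<open>CH2\<close> if \<open>\<phi> > 0\<close>; for \<open>\<phi> = 0\<close> distinctness is needed to express that
  their closures meet in exactly one point of the ideal boundary.
\<close>

definition meet_at_angle :: "complex^3 \<Rightarrow> complex^3 \<Rightarrow> real \<Rightarrow> bool" where
  "meet_at_angle c c' \<phi> \<longleftrightarrow>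
     0 \<le> \<phi> \<and> \<phi> \<le> pi / 2 \<and>
     complex_geodesic c \<noteq> complex_geodesic c' \<and> cmod (herm c c') = cos \<phi>"

subsection \<open>The group \<open>PU(2,1)\<close>\<close>

definition U21 :: "(complex^3^3) monoid" where
  "U21 = \<lparr>carrier = {A. \<forall>z w. herm (A *v z) (A *v w) = herm z w}, mult = (**), one = mat 1\<rparr>"

definition U21_scalars :: "(complex^3^3) set" where
  "U21_scalars = {mat u | u. cmod u = 1}"

definition PU21 :: "(complex^3^3) set monoid" where
  "PU21 = U21 Mod U21_scalars"

definition PU_class :: "complex^3^3 \<Rightarrow> (complex^3^3) set" where
  "PU_class A = U21_scalars #>\<^bsub>U21\<^esub> A"

lemma herm_nondeg:
  assumes "\<And>w. herm z w = 0" shows "z = 0"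
proof -
  have "herm z (axis 1 1) = z$1" "herm z (axis 2 1) = z$2" "herm z (axis 3 1) = - z$3"
    by (auto simp: herm_def axis_def)
  with assms show ?thesis by (simp add: vec_eq_iff forall_3)
qed

lemma mat_mult_vec [simp]: "mat u *v (z::complex^3) = u *s z"
  by (simp add: vec_eq_iff matrix_vector_mult_def mat_def if_distrib if_distribR sum.delta cong: if_cong)

lemma herm_scale: "herm (u *s z) (v *s w) = u * cnj v * herm z w"
  by (simp add: herm_def algebra_simps)

lemma group_U21: "group U21"
proof (rule groupI)
  fix A assume A: "A \<in> carrier U21"
  have "inj ((*v) A)"
  proof (rule injI)
    fix x y assume "A *v x = A *v y"
    then have e: "A *v (x - y) = 0" by (simp add: matrix_vector_mult_diff_distrib)
    have "herm (x - y) w = 0" for w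
    proof -
      have "herm (x - y) w = herm (A *v (x - y)) (A *v w)" using A by (simp add: U21_def)
      then show ?thesis unfolding e by (simp add: herm_def)
    qed
    then have "x - y = 0" by (rule herm_nondeg)
    then show "x = y" by simp
  qed
  then obtain B where B: "B ** A = mat 1" using matrix_left_invertible_injective by blast
  then have B': "A ** B = mat 1" using matrix_left_right_inverse by blast
  have "herm (B *v z) (B *v w) = herm z w" for z w
  proof -
    have "herm (B *v z) (B *v w) = herm (A *v (B *v z)) (A *v (B *v w))"
      using A by (simp add: U21_def)
    then show ?thesis by (simp add: matrix_vector_mul_assoc B')
  qed
  then show "\<exists>y\<in>carrier U21. y \<otimes>\<^bsub>U21\<^esub> A = \<one>\<^bsub>U21\<^esub>" using B by (auto simp: U21_def)
next
  fix A B assume "A \<in> carrier U21" "B \<in> carrier U21"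
  then show "A \<otimes>\<^bsub>U21\<^esub> B \<in> carrier U21"
    by (simp add: U21_def flip: matrix_vector_mul_assoc)
qed (simp_all add: U21_def matrix_mul_assoc)

lemma scalar_commute: "mat u ** A = A ** mat (u::complex)" for A :: "complex^3^3"
  by (simp add: matrix_eq vector_scalar_commute flip: matrix_vector_mul_assoc)

lemma mat_mult_mat: "mat u ** mat v = (mat (u * v) :: complex^3^3)"
  by (simp add: matrix_eq flip: matrix_vector_mul_assoc)

lemma U21_scalars_subset: "U21_scalars \<subseteq> carrier U21"
proof
  fix A assume "A \<in> U21_scalars"
  then obtain u where A: "A = mat u" and u: "cmod u = 1" unfolding U21_scalars_def by blast
  have "u * cnj u = 1" using complex_norm_square[of u] u by simp
  then show "A \<in> carrier U21" by (simp add: A U21_def herm_scale)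
qed

lemma normal_U21_scalars: "U21_scalars \<lhd> U21"
proof -
  interpret group U21 by (rule group_U21)
  have i: "inv\<^bsub>U21\<^esub> (mat u) \<in> U21_scalars" if "cmod u = 1" for u
  proof -
    have "inv\<^bsub>U21\<^esub> (mat u) = mat (inverse u)"
    proof (rule inv_equality)
      have "u \<noteq> 0" using that by auto
      then show "mat (inverse u) \<otimes>\<^bsub>U21\<^esub> mat u = \<one>\<^bsub>U21\<^esub>" by (simp add: U21_def mat_mult_mat)
      show "mat u \<in> carrier U21" using that U21_scalars_subset unfolding U21_scalars_def by blast
      have "cmod (inverse u) = 1" using that by (simp add: norm_inverse)
      then show "mat (inverse u) \<in> carrier U21" using U21_scalars_subset unfolding U21_scalars_def by blast
    qed
    moreover have "cmod (inverse u) = 1" using that by (simp add: norm_inverse)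
    ultimately show ?thesis unfolding U21_scalars_def by blast
  qed
  have s: "subgroup U21_scalars U21"
  proof (rule subgroupI)
    show "U21_scalars \<subseteq> carrier U21" by (rule U21_scalars_subset)
    show "U21_scalars \<noteq> {}" by (auto simp: U21_scalars_def intro: exI[of _ 1])
    fix a b assume "a \<in> U21_scalars" "b \<in> U21_scalars"
    then obtain u v where ab: "a = mat u" "b = mat v" "cmod u = 1" "cmod v = 1"
      unfolding U21_scalars_def by blast
    show "inv\<^bsub>U21\<^esub> a \<in> U21_scalars" unfolding ab(1) by (rule i) (rule ab(3))
    have "a \<otimes>\<^bsub>U21\<^esub> b = mat (u * v)" by (simp add: ab U21_def mat_mult_mat)
    moreover have "cmod (u * v) = 1" by (simp add: ab norm_mult)
    ultimately show "a \<otimes>\<^bsub>U21\<^esub> b \<in> U21_scalars" unfolding U21_scalars_def by blast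
  qed
  show ?thesis
  proof (rule normalI[OF s], rule ballI)
    fix A assume "A \<in> carrier U21"
    have "h \<otimes>\<^bsub>U21\<^esub> A = A \<otimes>\<^bsub>U21\<^esub> h" if "h \<in> U21_scalars" for h
    proof -
      from that obtain u where h: "h = mat u" unfolding U21_scalars_def by blast
      show ?thesis unfolding h U21_def by (simp, rule scalar_commute)
    qed
    then show "U21_scalars #>\<^bsub>U21\<^esub> A = A <#\<^bsub>U21\<^esub> U21_scalars"
      unfolding r_coset_def l_coset_def by simp
  qed
qed

lemma group_PU21: "group PU21"
  unfolding PU21_def by (rule normal.factorgroup_is_group[OF normal_U21_scalars])

text \<open>
  The quotient topology: the elements of \<^const>\<open>PU21\<close> are the fibres of the projection from
  \<^const>\<open>U21\<close>, so the preimage of a set of elements is its union.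
\<close>

definition PU21_topology :: "(complex^3^3) set topology" where
  "PU21_topology = topology (\<lambda>\<U>. \<U> \<subseteq> carrier PU21 \<and>
     openin (top_of_set (carrier U21)) (\<Union>\<U>))"

lemma openin_PU21_topology:
  "openin PU21_topology \<U> \<longleftrightarrow>
     \<U> \<subseteq> carrier PU21 \<and> openin (top_of_set (carrier U21)) (\<Union>\<U>)"
proof -
  interpret normal U21_scalars U21 by (rule normal_U21_scalars)
  have disj: "A = B" if "A \<in> carrier PU21" "B \<in> carrier PU21" "x \<in> A" "x \<in> B" for A B x
    using that rcos_disjoint[OF subgroup_axioms] unfolding PU21_def FactGroup_def pairwise_def disjnt_def by fastforce
  have I: "\<Union>(S \<inter> T) = \<Union>S \<inter> \<Union>T" if "S \<subseteq> carrier PU21" "T \<subseteq> carrier PU21" for S T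
    using that disj by blast
  have "istopology (\<lambda>\<U>. \<U> \<subseteq> carrier PU21 \<and> openin (top_of_set (carrier U21)) (\<Union>\<U>))"
    unfolding istopology_def
  proof (intro conjI allI impI)
    fix S T
    assume "S \<subseteq> carrier PU21 \<and> openin (top_of_set (carrier U21)) (\<Union> S)"
      "T \<subseteq> carrier PU21 \<and> openin (top_of_set (carrier U21)) (\<Union> T)"
    then show "openin (top_of_set (carrier U21)) (\<Union> (S \<inter> T))" by (simp add: I openin_Int)
  next
    fix K :: "(complex^3^3) set set set"
    assume K: "\<forall>S\<in>K. S \<subseteq> carrier PU21 \<and> openin (top_of_set (carrier U21)) (\<Union> S)"
    have "\<Union>(\<Union>K) = \<Union>((\<lambda>S. \<Union>S) ` K)" by blast
    then show "openin (top_of_set (carrier U21)) (\<Union> (\<Union> K))" using K by auto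
  qed auto
  then show ?thesis unfolding PU21_topology_def by (simp add: topology_inverse')
qed

definition eigenvalues :: "complex^3^3 \<Rightarrow> complex set" where
  "eigenvalues A = {x. \<exists>v. v \<noteq> 0 \<and> A *v v = x *s v}"

definition elliptic :: "(complex^3^3) set \<Rightarrow> bool" where
  "elliptic g \<longleftrightarrow> g \<in> carrier PU21 \<and> (\<exists>L\<in>CH2. \<forall>A\<in>g. (*v) A ` L = L)"

definition regular_elliptic :: "(complex^3^3) set \<Rightarrow> bool" where
  "regular_elliptic g \<longleftrightarrow> elliptic g \<and> (\<forall>A\<in>g. card (eigenvalues A) = 3)"

definition complex_reflection :: "complex^3 \<Rightarrow> complex^3^3" where
  "complex_reflection c = matrix (\<lambda>z. - z + (2 * herm z c) *s c)"

lemma complex_reflection_apply: "complex_reflection c *v z = - z + (2 * herm z c) *s c"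
proof -
  have "complex_reflection c *v z = (\<lambda>z. - z + (2 * herm z c) *s c) z"
   unfolding complex_reflection_def
   by (simp add: vec_eq_iff matrix_vector_mult_def matrix_def sum_3 forall_3 herm_def axis_def algebra_simps)
  then show ?thesis by simp
qed

lemma complex_reflection_in_U21: "normalised_polar c \<Longrightarrow> complex_reflection c \<in> carrier U21"
proof -
  assume "normalised_polar c"
  then have n: "herm c c = 1" by (simp add: normalised_polar_def)
  have cn: "herm c w = cnj (herm w c)" for w by (simp add: herm_def algebra_simps)
  have "herm (- z + a *s c) (- w + b *s c) = herm z w - cnj b * herm z c - a * cnj (herm w c) + a * cnj b" for z w a b
  proof -
    have "herm (- z + a *s c) (- w + b *s c) = herm z w - cnj b * herm z c - a * herm c w + a * cnj b * herm c c"
      by (simp add: herm_def algebra_simps)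
    also have "herm c w = cnj (herm w c)" by (rule cn)
    finally show ?thesis by (simp only: n mult_1_right)
  qed
  then show ?thesis by (simp add: U21_def complex_reflection_apply)
qed

subsection \<open>Groups given by generators and relators\<close>

text \<open>
  A letter \<open>(x, True)\<close> stands for the generator \<open>x\<close> and \<open>(x, False)\<close> for its inverse.
\<close>

type_synonym 'a gword = "('a \<times> bool) list"

inductive pres_eq :: "'a gword set \<Rightarrow> 'a gword \<Rightarrow> 'a gword \<Rightarrow> bool" for R where
  refl: "pres_eq R u u"
| sym: "pres_eq R u v \<Longrightarrow> pres_eq R v u"
| trans: "pres_eq R u v \<Longrightarrow> pres_eq R v w \<Longrightarrow> pres_eq R u w"
| cancel: "pres_eq R (u @ [(x, b), (x, \<not> b)] @ v) (u @ v)"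
| relator: "r \<in> R \<Longrightarrow> pres_eq R (u @ r @ v) (u @ v)"

definition pres_class :: "'a gword set \<Rightarrow> 'a gword \<Rightarrow> 'a gword set" where
  "pres_class R u = {v. pres_eq R u v}"

definition presented_group :: "'a gword set \<Rightarrow> 'a gword set monoid" where
  "presented_group R =
     \<lparr>carrier = range (pres_class R),
      mult = (\<lambda>U V. \<Union>u\<in>U. \<Union>v\<in>V. pres_class R (u @ v)),
      one = pres_class R []\<rparr>"

subsection \<open>Triangles and triangle groups\<close>

definition triangle_angle :: "enat \<Rightarrow> real" where
  "triangle_angle n = (case n of enat m \<Rightarrow> pi / real m | \<infinity> \<Rightarrow> 0)"

definition is_triangle :: "(3 \<Rightarrow> enat) \<Rightarrow> (3 \<Rightarrow> complex^3) \<Rightarrow> bool" where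
  "is_triangle p c \<longleftrightarrow>
     (\<forall>k. normalised_polar (c k)) \<and>
     (\<forall>k. meet_at_angle (c (k - 1)) (c (k + 1)) (triangle_angle (p k)))"

definition angular_invariant :: "(3 \<Rightarrow> complex^3) \<Rightarrow> real" where
  "angular_invariant c = Arg (\<Prod>k\<in>UNIV. herm (c (k - 1)) (c (k + 1)))"

text \<open>
  For \<open>\<alpha> = 0\<close> the parameter is infinite; the condition \<open>\<alpha> \<noteq> 0\<close> is needed because of the
  convention \<open>cot 0 = 0\<close>. The value of \<open>cot (\<alpha>/2)\<close> does not depend on the branch of the argument.
\<close>

definition has_parameter :: "(3 \<Rightarrow> complex^3) \<Rightarrow> real \<Rightarrow> bool" where
  "has_parameter c t \<longleftrightarrow> angular_invariant c \<noteq> 0 \<and> t = cot (angular_invariant c / 2)"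

definition threshold :: "real \<Rightarrow> ereal" where
  "threshold x =
     (if x \<ge> 1 then \<infinity> else if x < -1 then - \<infinity> else ereal (sqrt ((1 + x) / (1 - x))))"

definition triangle_relators :: "(3 \<Rightarrow> enat) \<Rightarrow> 3 gword set" where
  "triangle_relators p =
     {[(k, True), (k, True)] | k. True} \<union>
     {concat (replicate m [(k - 1, True), (k + 1, True)]) | k m. p k = enat m}"

definition triangle_group :: "(3 \<Rightarrow> enat) \<Rightarrow> 3 gword set monoid" where
  "triangle_group p = presented_group (triangle_relators p)"

definition triangle_gen :: "(3 \<Rightarrow> enat) \<Rightarrow> 3 \<Rightarrow> 3 gword set" where
  "triangle_gen p k = pres_class (triangle_relators p) [(k, True)]"

definition triangle_rep ::
  "(3 \<Rightarrow> enat) \<Rightarrow> (3 \<Rightarrow> complex^3) \<Rightarrow> (3 gword set \<Rightarrow> (complex^3^3) set) \<Rightarrow> bool" where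
  "triangle_rep p c \<rho> \<longleftrightarrow>
     \<rho> \<in> hom (triangle_group p) PU21 \<and>
     (\<forall>k. \<rho> (triangle_gen p k) = PU_class (complex_reflection (c k)))"

definition discrete_embedding ::
  "(3 \<Rightarrow> enat) \<Rightarrow> (3 gword set \<Rightarrow> (complex^3^3) set) \<Rightarrow> bool" where
  "discrete_embedding p \<rho> \<longleftrightarrow>
     inj_on \<rho> (carrier (triangle_group p)) \<and>
     subtopology PU21_topology (\<rho> ` carrier (triangle_group p)) =
       discrete_topology (\<rho> ` carrier (triangle_group p))"

end

theory Submission
  imports Defs
begin

text \<open>
  Since \<open>\<iota>\<^sub>3\<iota>\<^sub>2\<iota>\<^sub>3\<close> is the complex reflection with polar vector \<open>a = \<iota>\<^sub>3(c\<^sub>2)\<close>, the element \<open>w\<^sub>A\<close> is a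
  product of two complex reflections, and \<open>|\<langle>a, c\<^sub>1\<rangle>|\<^sup>2 = 4r\<^sub>1\<^sup>2r\<^sub>2\<^sup>2 + r\<^sub>3\<^sup>2 - 4r\<^sub>1r\<^sub>2r\<^sub>3 cos \<alpha>\<close>. The
  condition \<open>|t| > t\<^sub>A\<close> says that this is less than \<open>1\<close>, and \<open>\<alpha> \<noteq> 0\<close> makes it positive; then
  \<open>w\<^sub>A\<close> has a negative eigenvector and three distinct unimodular eigenvalues \<open>1, \<mu>, 1/\<mu>\<close>.

  Positive powers of \<open>w\<^sub>A\<close> therefore accumulate at the identity, so a discrete embedding would force
  \<open>\<gamma>\<^sub>3\<gamma>\<^sub>2\<gamma>\<^sub>3\<gamma>\<^sub>1\<close> to have finite order. In the geometric representation of the Coxeter group of the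
  triangle this element is a product of two reflections whose roots have inner product
  \<open>-(r\<^sub>3 + 2r\<^sub>1r\<^sub>2) \<le> -1\<close>, hence has infinite order.
\<close>

subsection \<open>Complex reflections\<close>

lemma herm_simps:
  "herm (x + y) z = herm x z + herm y z" "herm x (y + z) = herm x y + herm x z"
  "herm (x - y) z = herm x z - herm y z" "herm x (y - z) = herm x y - herm x z"
  "herm (- x) z = - herm x z" "herm x (- z) = - herm x z"
  "herm (u *s x) z = u * herm x z" "herm x (u *s z) = cnj u * herm x z"
  by (simp_all add: herm_def algebra_simps)

lemma cnj_herm: "cnj (herm z w) = herm w z"
  by (simp add: herm_def algebra_simps)

lemma complex_reflection_involution:
  assumes "normalised_polar c"
  shows "complex_reflection c *v (complex_reflection c *v z) = z"
  using assms
  by (simp add: complex_reflection_apply normalised_polar_def herm_simps vec_eq_iff algebra_simps)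

text \<open>A complex reflection is self-adjoint for \<open>herm\<close>, so conjugating by the
  involution in \<open>c\<close> just moves the polar vector \<open>d\<close>.\<close>

lemma complex_reflection_conjugate:
  assumes "normalised_polar c"
  shows "complex_reflection c ** complex_reflection d ** complex_reflection c =
         complex_reflection (complex_reflection c *v d)"
proof -
  let ?R = "complex_reflection c"
  have "herm (?R *v z) d = herm z (?R *v d)" for z
    by (simp add: complex_reflection_apply herm_simps cnj_herm algebra_simps)
  then have "?R *v (complex_reflection d *v (?R *v z)) =
      complex_reflection (?R *v d) *v z" for z
    using complex_reflection_involution[OF assms, of z]
    by (simp add: complex_reflection_apply[of d] complex_reflection_apply[of "?R *v d"]
        matrix_vector_mult_diff_distrib matrix_vector_right_distrib vector_scalar_commute)
  then show ?thesis
    by (simp add: matrix_eq flip: matrix_vector_mul_assoc)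
qed

text \<open>The Gram matrix of \<open>a\<close> and \<open>b\<close> is positive definite, so
  removing from a negative vector its projection to their span leaves a negative vector.
  Geometrically \<open>n\<close> is the point where the two complex geodesics meet.\<close>

lemma complement_of_positive_plane:
  assumes "herm a a = 1" "herm b b = 1" "cmod (herm a b) < 1"
  obtains n where "herm n a = 0" "herm n b = 0" "Re (herm n n) < 0"
proof -
  define g where "g = herm a b"
  have g: "cmod g < 1" and ba: "herm b a = cnj g"
    using assms(3) by (simp_all add: g_def cnj_herm)
  have gg: "g * cnj g = of_real ((cmod g)\<^sup>2)" by (rule complex_norm_square[symmetric])
  have "(cmod g)\<^sup>2 < 1" using g by (simp add: power_less_one_iff abs_square_less_1)
  then have "of_real ((cmod g)\<^sup>2) \<noteq> (1::complex)" by (metis of_real_eq_1_iff less_irrefl)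
  then have d: "1 - g * cnj g \<noteq> 0" unfolding gg by simp
  define e :: "complex^3" where "e = axis 3 1"
  \<comment> \<open>Cramer's rule for the projection \<open>q\<close> of \<open>e\<close> to the
    span of \<open>a\<close> and \<open>b\<close>; the Gram determinant is
    \<open>1 - g * cnj g\<close>.\<close>
  define x where "x = (herm e a - cnj g * herm e b) / (1 - g * cnj g)"
  define y where "y = (herm e b - g * herm e a) / (1 - g * cnj g)"
  define q where "q = x *s a + y *s b"
  define n where "n = e - q"
  have x: "(1 - g * cnj g) * x = herm e a - cnj g * herm e b"
   and y: "(1 - g * cnj g) * y = herm e b - g * herm e a" using d by (simp_all add: x_def y_def)
  have "(1 - g * cnj g) * herm n a =
     (1 - g * cnj g) * herm e a - (1 - g * cnj g) * x - ((1 - g * cnj g) * y) * cnj g"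
    by (simp add: n_def q_def herm_simps assms ba algebra_simps)
  also have "\<dots> = 0" unfolding x y by (simp add: algebra_simps)
  finally have na: "herm n a = 0" using d by simp
  have "(1 - g * cnj g) * herm n b =
     (1 - g * cnj g) * herm e b - ((1 - g * cnj g) * x) * g - (1 - g * cnj g) * y"
    by (simp add: n_def q_def herm_simps assms g_def[symmetric] algebra_simps)
  also have "\<dots> = 0" unfolding x y by (simp add: algebra_simps)
  finally have nb: "herm n b = 0" using d by simp
  have "herm n q = 0" by (simp add: q_def herm_simps na nb)
  then have qn: "herm q n = 0" by (metis cnj_herm complex_cnj_zero)
  have "herm e e = herm n n + herm q q + herm n q + herm q n"
    by (simp add: n_def herm_simps)
  moreover have "herm e e = -1" by (simp add: e_def herm_def axis_def)
  ultimately have ee: "herm n n = - 1 - herm q q" using qn \<open>herm n q = 0\<close> by (simp add: algebra_simps)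
  have "herm q q = x * cnj x + y * cnj y + (x * cnj y * g + cnj (x * cnj y * g))"
    by (simp add: q_def herm_simps assms ba g_def[symmetric] algebra_simps)
  then have "Re (herm q q) = (cmod x)\<^sup>2 + (cmod y)\<^sup>2 + 2 * Re (x * cnj y * g)"
    unfolding cmod_power2 by (simp add: power2_eq_square algebra_simps)
  \<comment> \<open>Since |g| < 1, the cross term is at least -2|x||y|, so the norm of
    \<open>q\<close> is bounded below by (|x| - |y|)^2.\<close>
  moreover have "- Re (x * cnj y * g) \<le> cmod x * cmod y"
  proof -
    have "- Re (x * cnj y * g) \<le> cmod (x * cnj y * g)"
      using abs_Re_le_cmod[of "x * cnj y * g"] by linarith
    also have "\<dots> = (cmod x * cmod y) * cmod g" by (simp add: norm_mult)
    also have "\<dots> \<le> cmod x * cmod y" using g by (intro mult_left_le) auto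
    finally show ?thesis .
  qed
  moreover have "0 \<le> (cmod x - cmod y)\<^sup>2" by simp
  ultimately have "0 \<le> Re (herm q q)" by (simp add: power2_diff)
  then have "Re (herm n n) < 0" by (simp add: ee)
  with na nb show thesis by (rule that)
qed

text \<open>Both reflections negate a vector orthogonal to \<open>a\<close> and \<open>b\<close>, so
  \<open>W\<close> fixes it. With respect to \<open>a\<close> and \<open>b\<close>, \<open>W\<close>
  has determinant 1 and trace 4h - 2, where h = |<a,b>|^2. For 0 < h < 1 the discriminant 16h(h - 1)
  is negative, so the two roots are conjugate, non-real and unimodular.\<close>

lemma reflection_product_eigenvectors:
  assumes a: "herm a a = 1" and b: "herm b b = 1"
    and h: "herm a b \<noteq> 0" "cmod (herm a b) < 1"
  defines "W \<equiv> complex_reflection a ** complex_reflection b"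
  obtains n v w \<mu> where "Re (herm n n) < 0" "v \<noteq> 0" "w \<noteq> 0"
    "W *v n = n" "W *v v = \<mu> *s v" "W *v w = cnj \<mu> *s w" "cmod \<mu> = 1" "Im \<mu> \<noteq> 0"
proof -
  define g where "g = herm a b"
  define h where "h = (cmod g)\<^sup>2"
  have ba: "herm b a = cnj g" by (simp add: g_def cnj_herm)
  have gg: "g * cnj g = of_real h" unfolding h_def by (rule complex_norm_square[symmetric])
  have h0: "0 < h" using assms(3) by (simp add: h_def g_def)
  have h1: "h < 1" using assms(4) by (simp add: h_def g_def abs_square_less_1)
  obtain n where n: "herm n a = 0" "herm n b = 0" "Re (herm n n) < 0"
    using complement_of_positive_plane[OF a b assms(4)] .
  define s where "s = sqrt (h * (1 - h))"
  have s: "s \<noteq> 0" "s\<^sup>2 = h * (1 - h)" using h0 h1 by (auto simp: s_def)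
  define \<mu> where "\<mu> = Complex (2 * h - 1) (2 * s)"
  have Wn: "W *v n = n"
    by (simp add: W_def complex_reflection_apply herm_simps n flip: matrix_vector_mul_assoc)
  \<comment> \<open>The coefficients come from the \<open>b\<close>-row of the 2x2 eigenvalue
    equation; the \<open>a\<close>-row is then the characteristic equation.\<close>
  have eig: "W *v ((1 + \<nu>) *s a - (2 * g) *s b) = \<nu> *s ((1 + \<nu>) *s a - (2 * g) *s b)"
    if "\<nu>\<^sup>2 + (2 - 4 * h) * \<nu> + 1 = 0" for \<nu> :: complex
  proof -
    have Wa: "W *v a = (4 * h - 1) *s a - (2 * g) *s b"
      by (simp add: W_def complex_reflection_apply herm_simps a b ba g_def[symmetric]
          vec_eq_iff algebra_simps flip: matrix_vector_mul_assoc gg)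
    have Wb: "W *v b = (2 * cnj g) *s a - b"
      by (simp add: W_def complex_reflection_apply herm_simps a b ba g_def[symmetric]
          vec_eq_iff algebra_simps flip: matrix_vector_mul_assoc)
    have c: "(1 + \<nu>) * (4 * h - 1) - 2 * g * (2 * cnj g) = \<nu> * (1 + \<nu>)"
    proof -
      have "2 * g * (2 * cnj g) = 4 * of_real h" unfolding gg[symmetric] by simp
      then show ?thesis using that by (simp only:) (simp add: algebra_simps power2_eq_square)
    qed
    have "W *v ((1 + \<nu>) *s a - (2 * g) *s b) = 
        ((1 + \<nu>) * (4 * h - 1) - 2 * g * (2 * cnj g)) *s a - (\<nu> * (2 * g)) *s b"
      by (simp add: matrix_vector_mult_diff_distrib vector_scalar_commute Wa Wb vec_eq_iff algebra_simps)
    then show ?thesis unfolding c by (simp add: vec_eq_iff algebra_simps)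
  qed
  \<comment> \<open>Pairing with \<open>a\<close> gives 1 + \<nu> - 2h, which for the two roots is
    purely imaginary and nonzero.\<close>
  have nz: "(1 + \<nu>) *s a - (2 * g) *s b \<noteq> 0" if "1 + \<nu> \<noteq> 2 * h" for \<nu> :: complex
  proof
    assume "(1 + \<nu>) *s a - (2 * g) *s b = 0"
    then have "herm ((1 + \<nu>) *s a - (2 * g) *s b) a = 0" by (simp add: herm_def)
    then show False using that by (simp add: herm_simps a ba gg)
  qed
  have root: "\<mu>\<^sup>2 + (2 - 4 * h) * \<mu> + 1 = 0" 
    using s(2) by (simp add: \<mu>_def complex_eq_iff power2_eq_square algebra_simps)
  have root': "(cnj \<mu>)\<^sup>2 + (2 - 4 * h) * cnj \<mu> + 1 = 0" 
    using s(2) by (simp add: \<mu>_def complex_eq_iff power2_eq_square algebra_simps)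
  show thesis
  proof (rule that[OF n(3) nz nz Wn eig[OF root] eig[OF root']])
    show "1 + \<mu> \<noteq> 2 * h" "1 + cnj \<mu> \<noteq> 2 * h" "Im \<mu> \<noteq> 0"
      using s(1) by (simp_all add: \<mu>_def complex_eq_iff)
    have "(cmod \<mu>)\<^sup>2 = 1" using s(2) unfolding cmod_power2 by (simp add: \<mu>_def power2_eq_square algebra_simps)
    then show "cmod \<mu> = 1" using norm_ge_zero[of \<mu>] unfolding power2_eq_1_iff by linarith
  qed
qed

subsection \<open>Matrices with unimodular spectrum\<close>

lemma eigenvectors_independent:
  fixes A :: "complex^'n^'n" and v :: "'i \<Rightarrow> complex^'n"
  assumes "finite S" "inj_on l S" "\<And>i. i \<in> S \<Longrightarrow> A *v v i = l i *s v i" "\<And>i. i \<in> S \<Longrightarrow> v i \<noteq> 0"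
    and "(\<Sum>i\<in>S. x i *s v i) = 0" "i \<in> S"
  shows "x i = 0"
  using assms
proof (induction S arbitrary: x i rule: finite_induct)
  case (insert j S)
  let ?z = "\<Sum>i\<in>insert j S. x i *s v i"
  \<comment> \<open>Applying A - l_j kills the \<open>j\<close>-th term and rescales the others by
    nonzero factors.\<close>
  have "A *v ?z - l j *s ?z = (\<Sum>i\<in>insert j S. (x i * (l i - l j)) *s v i)"
    using insert.prems(2)
    by (simp add: vec.linear_sum[OF matrix_vector_mul_linear_gen] vector_scalar_commute
        vec.scale_sum_right vec.scale_left_diff_distrib algebra_simps flip: sum_subtractf)
  then have "(\<Sum>i\<in>S. (x i * (l i - l j)) *s v i) = 0"
    using insert.prems(4) insert.hyps by simp
  then have "x i * (l i - l j) = 0" if "i \<in> S" for i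
    using insert.IH[of "\<lambda>i. x i * (l i - l j)" i] insert.prems that by (auto intro: inj_on_subset)
  moreover have "l i \<noteq> l j" if "i \<in> S" for i
    using insert.prems(1) insert.hyps(2) that by (auto simp: inj_on_def)
  ultimately have S: "x i = 0" if "i \<in> S" for i using that by auto
  then have "x j *s v j = 0" using insert.prems(4) insert.hyps by simp
  then have "x j = 0" using insert.prems(3) by auto
  with S insert.prems(5) show ?case by auto
qed simp


text \<open>The eigenvectors are indexed by the coordinate type itself, so they are the columns of a
  square matrix; independence makes it injective, hence invertible.\<close>

lemma eigenbasis_spans:
  fixes A :: "complex^'n^'n" and v :: "'n \<Rightarrow> complex^'n"
  assumes "inj l" "\<And>i. A *v v i = l i *s v i" "\<And>i. v i \<noteq> 0"
  obtains x where "z = (\<Sum>i\<in>UNIV. x i *s v i)"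
proof -
  define V :: "complex^'n^'n" where "V = (\<chi> i j. v j $ i)"
  have V: "V *v x = (\<Sum>i\<in>UNIV. x $ i *s v i)" for x
    by (simp add: V_def matrix_mult_sum column_def)
  have "inj ((*v) V)"
  proof (rule injI)
    fix x y assume "V *v x = V *v y"
    then have "(\<Sum>i\<in>UNIV. (x - y) $ i *s v i) = 0"
      unfolding V[symmetric] by (simp add: matrix_vector_mult_diff_distrib)
    then have "(x - y) $ i = 0" for i
      using eigenvectors_independent[of UNIV l A v "\<lambda>i. (x - y) $ i" i] assms by simp
    then show "x = y" by (simp add: vec_eq_iff)
  qed
  then obtain B where "B ** V = mat 1" using matrix_left_invertible_injective by blast
  then have "V ** B = mat 1" using matrix_left_right_inverse by blast
  then have "z = V *v (B *v z)" by (simp add: matrix_vector_mul_assoc)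
  then show thesis unfolding V by (rule that)
qed

lemma eigenvalues_eq_range:
  assumes "inj l" "\<And>i. A *v v i = l i *s v i" "\<And>i. v i \<noteq> 0"
  shows "eigenvalues A = range (l :: 3 \<Rightarrow> complex)"
proof (intro equalityI subsetI)
  fix \<mu> assume "\<mu> \<in> eigenvalues A"
  then obtain z where z: "z \<noteq> 0" "A *v z = \<mu> *s z" unfolding eigenvalues_def by blast
  obtain x where x: "z = (\<Sum>i\<in>UNIV. x i *s v i)" using eigenbasis_spans[OF assms] .
  have "(\<Sum>i\<in>UNIV. (x i * (l i - \<mu>)) *s v i) = A *v z - \<mu> *s z"
    unfolding x using assms(2)
    by (simp add: vec.linear_sum[OF matrix_vector_mul_linear_gen] vector_scalar_commute
        vec.scale_sum_right vec.scale_left_diff_distrib algebra_simps flip: sum_subtractf)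
  then have "x i * (l i - \<mu>) = 0" for i
    using eigenvectors_independent[of UNIV l A v "\<lambda>i. x i * (l i - \<mu>)" i] assms z(2) by simp
  moreover obtain i where "x i \<noteq> 0"
    using z(1) unfolding x by (metis (no_types, lifting) sum.neutral vec.scale_zero_left)
  ultimately have "l i = \<mu>" by (metis eq_iff_diff_eq_0 mult_eq_0_iff)
  then show "\<mu> \<in> range l" by blast
qed (use assms(2,3) in \<open>auto simp: eigenvalues_def\<close>)

text \<open>Compactness of the torus: the powers have a convergent subsequence, and quotients of its
  consecutive terms are positive powers tending to 1. Roots of unity need no separate
  treatment.\<close>

lemma unimodular_powers_recurrent:
  fixes l :: "'n::finite \<Rightarrow> complex"
  assumes l: "\<And>i. cmod (l i) = 1"
  obtains \<nu> :: "nat \<Rightarrow> nat" where "\<And>k. 0 < \<nu> k" "\<And>i. (\<lambda>k. l i ^ \<nu> k) \<longlonglongrightarrow> 1"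
proof -
  define X :: "nat \<Rightarrow> complex^'n" where "X n = (\<chi> i. l i ^ n)" for n
  have "norm (X n) \<le> CARD('n)" for n
    using L2_set_le_sum[of UNIV "\<lambda>i. cmod (X n $ i)"] by (simp add: norm_vec_def X_def norm_power l)
  then have "bounded (range X)" by (auto simp: bounded_iff)
  then obtain L \<phi> where \<phi>: "strict_mono \<phi>" and L: "(X \<circ> \<phi>) \<longlonglongrightarrow> L"
    using bounded_imp_convergent_subsequence by blast
  show thesis
  proof (rule that)
    show "0 < \<phi> (Suc k) - \<phi> k" for k using strict_monoD[OF \<phi>, of k "Suc k"] by simp
    show "(\<lambda>k. l i ^ (\<phi> (Suc k) - \<phi> k)) \<longlonglongrightarrow> 1" for i
    proof -
      have a: "(\<lambda>k. l i ^ \<phi> k) \<longlonglongrightarrow> L $ i"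
        using tendsto_vec_nth[OF L, of i] by (simp add: X_def)
      \<comment> \<open>Multiplication by a unimodular number is isometric, so the distance to 1 is
        the distance between consecutive terms of a convergent sequence.\<close>
      have b: "cmod (l i ^ (\<phi> (Suc k) - \<phi> k) - 1) = cmod (l i ^ \<phi> (Suc k) - l i ^ \<phi> k)" for k
      proof -
        have "\<phi> k \<le> \<phi> (Suc k)" using strict_monoD[OF \<phi>, of k "Suc k"] by simp
        then have "l i ^ \<phi> (Suc k) - l i ^ \<phi> k = l i ^ \<phi> k * (l i ^ (\<phi> (Suc k) - \<phi> k) - 1)"
          by (simp add: right_diff_distrib flip: power_add)
        then show ?thesis by (simp add: norm_mult norm_power l)
      qed
      have "(\<lambda>k. l i ^ \<phi> (Suc k) - l i ^ \<phi> k) \<longlonglongrightarrow> 0"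
        using tendsto_diff[OF LIMSEQ_Suc[OF a] a] by simp
      then have "(\<lambda>k. l i ^ (\<phi> (Suc k) - \<phi> k) - 1) \<longlonglongrightarrow> 0"
        using tendsto_norm_zero_cancel[of "\<lambda>k. l i ^ (\<phi> (Suc k) - \<phi> k) - 1"] tendsto_norm_zero
        unfolding b by blast
      then show ?thesis by (simp add: LIM_zero_iff)
    qed
  qed
qed

lemma U21_pow_eigenvector:
  assumes "A *v v = \<mu> *s v"
  shows "(A [^]\<^bsub>U21\<^esub> (n::nat)) *v v = \<mu> ^ n *s v"
proof (induction n)
  case (Suc n)
  have "(A [^]\<^bsub>U21\<^esub> Suc n) *v v = (A [^]\<^bsub>U21\<^esub> n) *v (A *v v)"
    by (simp add: U21_def flip: matrix_vector_mul_assoc)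
  then show ?case by (simp add: assms Suc vector_scalar_commute mult.commute)
qed (simp add: U21_def)

text \<open>In the eigenbasis the powers act by scalars that tend to 1 along a common sequence of
  exponents. Convergence on the standard basis vectors is convergence of the matrix entries.\<close>

lemma unimodular_spectrum_recurrent:
  fixes A :: "complex^3^3" and l :: "3 \<Rightarrow> complex"
  assumes "inj l" "\<And>i. A *v v i = l i *s v i" "\<And>i. v i \<noteq> 0" "\<And>i. cmod (l i) = 1"
  obtains \<nu> :: "nat \<Rightarrow> nat"
  where "\<And>k. 0 < \<nu> k" "(\<lambda>k. A [^]\<^bsub>U21\<^esub> \<nu> k) \<longlonglongrightarrow> mat 1"
proof -
  obtain \<nu> :: "nat \<Rightarrow> nat" where \<nu>: "\<And>k. 0 < \<nu> k" "\<And>i. (\<lambda>k. l i ^ \<nu> k) \<longlonglongrightarrow> 1"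
    using unimodular_powers_recurrent[of l] assms(4) by blast
  have lim: "(\<lambda>k. (A [^]\<^bsub>U21\<^esub> \<nu> k) *v z) \<longlonglongrightarrow> z" for z
  proof -
    obtain x where x: "z = (\<Sum>i\<in>UNIV. x i *s v i)" using eigenbasis_spans[OF assms(1-3)] .
    have "(A [^]\<^bsub>U21\<^esub> \<nu> k) *v z = (\<Sum>i\<in>UNIV. (l i ^ \<nu> k * x i) *s v i)" for k
      unfolding x
      by (simp add: vec.linear_sum[OF matrix_vector_mul_linear_gen] vector_scalar_commute
          U21_pow_eigenvector[OF assms(2)] mult.commute)
    moreover have "(\<lambda>k. \<Sum>i\<in>UNIV. (l i ^ \<nu> k * x i) *s v i) \<longlonglongrightarrow> (\<Sum>i\<in>UNIV. (1 * x i) *s v i)"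
      unfolding vector_scalar_mult_def by (intro tendsto_intros tendsto_vec_lambda \<nu>)
    ultimately show ?thesis by (simp add: x)
  qed
  have basis: "(M *v axis j 1) $ i = M $ i $ j" for M :: "complex^3^3" and i j
    by (simp add: matrix_vector_mult_def axis_def if_distrib cong: if_cong)
  have "(\<lambda>k. (A [^]\<^bsub>U21\<^esub> \<nu> k) $ i $ j) \<longlonglongrightarrow> mat 1 $ i $ j" for i j
    using tendsto_vec_nth[OF lim[of "axis j 1"], of i]
    by (simp add: basis) (simp add: mat_def axis_def)
  then show thesis by (intro that[OF \<nu>(1)] vec_tendstoI)
qed

subsection \<open>The projective group\<close>

lemma PU_class_mult:
  assumes "A \<in> carrier U21" "B \<in> carrier U21"
  shows "PU_class A \<otimes>\<^bsub>PU21\<^esub> PU_class B = PU_class (A ** B)"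
  using normal.rcos_sum[OF normal_U21_scalars assms]
  by (simp add: PU21_def FactGroup_def PU_class_def U21_def)

lemma one_PU21: "\<one>\<^bsub>PU21\<^esub> = PU_class (mat 1)"
  using group.coset_mult_one[OF group_U21 U21_scalars_subset]
  by (simp add: PU21_def FactGroup_def PU_class_def U21_def)

lemma carrier_PU21: "carrier PU21 = PU_class ` carrier U21"
  by (auto simp: PU21_def FactGroup_def PU_class_def RCOSETS_def)

lemma mem_PU_class: "B \<in> PU_class A \<longleftrightarrow> (\<exists>u. cmod u = 1 \<and> B = mat u ** A)"
  by (auto simp: PU_class_def r_coset_def U21_scalars_def U21_def)

lemma PU_class_eqI:
  assumes "A \<in> carrier U21" "X \<in> carrier PU21" "A \<in> X"
  shows "X = PU_class A"
proof -
  interpret normal U21_scalars U21 by (rule normal_U21_scalars)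
  from assms(2) obtain B where "B \<in> carrier U21" "X = PU_class B" unfolding carrier_PU21 by blast
  moreover have "PU_class B = PU_class A"
    unfolding PU_class_def
    by (rule repr_independence[OF _ \<open>B \<in> carrier U21\<close> subgroup_axioms])
      (use assms(3) \<open>X = PU_class B\<close> in \<open>simp add: PU_class_def\<close>)
  ultimately show ?thesis by simp
qed

text \<open>An open set isolating the identity class in \<open>H\<close> has an open preimage in
  U(2,1) containing \<open>mat 1\<close>, so convergence of representatives is enough.\<close>

lemma discrete_subset_eventually_one:
  assumes "subtopology PU21_topology H = discrete_topology H" "PU_class (mat 1) \<in> H"
    and "\<And>k. A k \<in> carrier U21" "\<And>k. PU_class (A k) \<in> H" "A \<longlonglongrightarrow> mat 1"
  shows "\<forall>\<^sub>F k in sequentially. PU_class (A k) = PU_class (mat 1)"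
proof -
  have "openin (subtopology PU21_topology H) {PU_class (mat 1)}"
    using assms(1,2) by simp
  then obtain \<U> where \<U>: "openin PU21_topology \<U>" "{PU_class (mat 1)} = \<U> \<inter> H"
    unfolding openin_subtopology by blast
  then have \<U>c: "\<U> \<subseteq> carrier PU21" and "openin (top_of_set (carrier U21)) (\<Union>\<U>)"
    by (simp_all add: openin_PU21_topology)
  then obtain T where T: "open T" "\<Union>\<U> = carrier U21 \<inter> T" unfolding openin_open by blast
  have "mat 1 \<in> PU_class (mat 1)" unfolding mem_PU_class by (auto intro!: exI[of _ 1])
  then have "mat 1 \<in> T" using \<U>(2) T(2) by blast
  then have "\<forall>\<^sub>F k in sequentially. A k \<in> T" using assms(5) T(1) by (rule topological_tendstoD[rotated 2])
  then show ?thesis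
  proof (rule eventually_mono)
    fix k assume "A k \<in> T"
    then obtain X where "X \<in> \<U>" "A k \<in> X" using assms(3) T(2) by blast
    then have "PU_class (A k) \<in> \<U>" using PU_class_eqI[OF assms(3)] \<U>c by blast
    then show "PU_class (A k) = PU_class (mat 1)" using assms(4) \<U>(2) by blast
  qed
qed

text \<open>\<open>elliptic\<close> and \<open>regular_elliptic\<close> quantify over all
  representatives of a class. These differ by unimodular scalars, which preserve lines and multiply
  all eigenvalues by the same factor, so one representative decides.\<close>

lemma regular_elliptic_PU_class:
  assumes A: "A \<in> carrier U21" and n: "Re (herm n n) < 0" "A *v n = \<mu> *s n"
    and card: "card (eigenvalues A) = 3"
  shows "regular_elliptic (PU_class A)"
proof -
  \<comment> \<open>In particular \<mu> is nonzero, so the line of \<open>n\<close> is mapped onto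
    itself and not merely into itself.\<close>
  have un: "cmod \<mu> = 1"
  proof -
    have "herm n n = herm (A *v n) (A *v n)" using A by (simp add: U21_def)
    also have "\<dots> = \<mu> * cnj \<mu> * herm n n" unfolding n(2) herm_scale ..
    finally have "\<mu> * cnj \<mu> * herm n n = 1 * herm n n" by simp
    moreover have "herm n n \<noteq> 0" using n(1) by auto
    ultimately have "\<mu> * cnj \<mu> = 1" unfolding mult_cancel_right by blast
    then have "complex_of_real ((cmod \<mu>)\<^sup>2) = 1" unfolding complex_norm_square .
    then have "(cmod \<mu>)\<^sup>2 = 1" using of_real_eq_1_iff by blast
    then show ?thesis using norm_ge_zero[of \<mu>] unfolding power2_eq_1_iff by linarith
  qed
  have "(*v) B ` proj_point n = proj_point n" if "B \<in> PU_class A" for B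
  proof -
    from that obtain u where u: "cmod u = 1" "B = mat u ** A" unfolding mem_PU_class by blast
    have B: "B *v (s *s n) = (s * (u * \<mu>)) *s n" for s
      using n(2) by (simp add: u(2) vector_scalar_commute mult_ac flip: matrix_vector_mul_assoc)
    have "u * \<mu> \<noteq> 0" using u(1) un by auto
    then have "range (\<lambda>s. s * (u * \<mu>)) = UNIV" by (intro surjI[of _ "\<lambda>s. s / (u * \<mu>)"]) simp
    moreover have "(*v) B ` proj_point n = (\<lambda>s. s *s n) ` range (\<lambda>s. s * (u * \<mu>))"
      by (simp add: proj_point_def image_image B)
    ultimately show ?thesis by (simp add: proj_point_def)
  qed
  moreover have "proj_point n \<in> CH2" using n(1) by (auto simp: CH2_def)
  moreover have "PU_class A \<in> carrier PU21" using A by (simp add: carrier_PU21)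
  moreover have "card (eigenvalues B) = 3" if "B \<in> PU_class A" for B
  proof -
    from that obtain u where u: "cmod u = 1" "B = mat u ** A" unfolding mem_PU_class by blast
    have u0: "u \<noteq> 0" using u(1) by auto
    have "u *s (A *v v) = x *s v \<longleftrightarrow> A *v v = (x / u) *s v" for x v
      using u0 by (auto simp: vec_eq_iff field_simps)
    then have "eigenvalues B = {x. x / u \<in> eigenvalues A}"
      by (simp add: eigenvalues_def u(2) flip: matrix_vector_mul_assoc)
    also have "\<dots> = (\<lambda>x. x * u) ` eigenvalues A" using u0 by (force simp: image_iff)
    finally show ?thesis using u0 card by (simp add: card_image inj_on_def)
  qed
  ultimately show ?thesis unfolding regular_elliptic_def elliptic_def by blast
qed

subsection \<open>Presented groups\<close>

lemma pres_eq_context: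
  assumes "pres_eq R u v"
  shows "pres_eq R (a @ u @ b) (a @ v @ b)"
  using assms
proof induction
  case (cancel u x c v)
  show ?case using pres_eq.cancel[of R "a @ u" x c "v @ b"] by simp
next
  case (relator r u v)
  show ?case using pres_eq.relator[OF relator, of "a @ u" "v @ b"] by simp
qed (blast intro: pres_eq.intros)+

lemma pres_class_eq_iff: "pres_class R u = pres_class R v \<longleftrightarrow> pres_eq R u v"
  by (auto simp: pres_class_def intro: pres_eq.intros)

text \<open>The product is encoded as a union over all representatives; since \<open>pres_eq\<close>
  is a congruence, all the sets in the union coincide.\<close>

lemma presented_group_mult:
  "pres_class R u \<otimes>\<^bsub>presented_group R\<^esub> pres_class R v = pres_class R (u @ v)"
proof -
  have "pres_class R (u' @ v') = pres_class R (u @ v)"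
    if "u' \<in> pres_class R u" "v' \<in> pres_class R v" for u' v'
  proof -
    have "pres_eq R u u'" "pres_eq R v v'" using that by (simp_all add: pres_class_def)
    then have "pres_eq R (u @ v) (u' @ v)" "pres_eq R (u' @ v) (u' @ v')"
      using pres_eq_context[of R u u' "[]" v] pres_eq_context[of R v v' u' "[]"] by simp_all
    then show ?thesis unfolding pres_class_eq_iff by (metis pres_eq.sym pres_eq.trans)
  qed
  moreover have "u \<in> pres_class R u" "v \<in> pres_class R v"
    by (simp_all add: pres_class_def pres_eq.refl)
  ultimately have "(\<Union>u'\<in>pres_class R u. \<Union>v'\<in>pres_class R v. pres_class R (u' @ v')) =
      pres_class R (u @ v)" by blast
  then show ?thesis by (simp add: presented_group_def)
qed

text \<open>The generators act by involutions, so the exponents of the letters are immaterial.\<close>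

lemma pres_eq_action:
  fixes s :: "'a \<Rightarrow> 'b \<Rightarrow> 'b"
  assumes "pres_eq R u v" "\<And>k x. s k (s k x) = x"
    and "\<And>r x. r \<in> R \<Longrightarrow> foldr (\<lambda>a. s (fst a)) r x = x"
  shows "foldr (\<lambda>a. s (fst a)) u = foldr (\<lambda>a. s (fst a)) v"
  using assms(1) by induction (simp_all add: assms(2,3) fun_eq_iff)

lemma foldr_concat_replicate:
  "foldr f (concat (replicate n w)) = (foldr f w) ^^ n"
  by (induction n) (simp_all add: fun_eq_iff)

subsection \<open>The geometric representation of a triangle group\<close>

definition reflection :: "('v \<Rightarrow> real) \<Rightarrow> 'v \<Rightarrow> 'v::real_vector \<Rightarrow> 'v" where
  "reflection \<phi> e x = x - (2 * \<phi> x) *\<^sub>R e"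

lemma linear_reflection:
  assumes "linear \<phi>" shows "linear (reflection \<phi> e)"
  by (rule linearI)
    (simp_all add: reflection_def linear_add[OF assms] linear_cmul[OF assms] algebra_simps)

lemma reflection_involution:
  assumes "linear \<phi>" "\<phi> e = 1"
  shows "reflection \<phi> e (reflection \<phi> e x) = x"
  by (simp add: reflection_def linear_diff[OF assms(1)] linear_cmul[OF assms(1)] assms(2) algebra_simps)

lemma reflection_on_plane:
  assumes "linear \<phi>" "\<phi> e = 1"
  shows "reflection \<phi> e (a *\<^sub>R e + b *\<^sub>R f) = (- a - 2 * b * \<phi> f) *\<^sub>R e + b *\<^sub>R f"
proof -
  have "\<phi> (a *\<^sub>R e + b *\<^sub>R f) = a + b * \<phi> f"
    by (simp add: linear_add[OF assms(1)] linear_cmul[OF assms(1)] assms(2))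
  then have "reflection \<phi> e (a *\<^sub>R e + b *\<^sub>R f) = (a - 2 * (a + b * \<phi> f)) *\<^sub>R e + b *\<^sub>R f"
    by (simp only: reflection_def scaleR_left_diff_distrib) simp
  moreover have "a - 2 * (a + b * \<phi> f) = - a - 2 * b * \<phi> f" by (simp add: algebra_simps)
  ultimately show ?thesis by simp
qed

lemma linear_funpow:
  fixes f :: "'v::real_vector \<Rightarrow> 'v"
  assumes "linear f" shows "linear (f ^^ n)"
  using assms
proof (induction n)
  case (Suc n)
  then show ?case using linear_compose[of "f ^^ n" f] by (simp add: comp_def)
qed (simp add: linear_id[unfolded id_def] id_def)

text \<open>
  On the span of \<open>e\<close> and \<open>f\<close> the product of the reflections is the rotation by \<open>2 \<theta>\<close>, and it fixes
  the common kernel of \<open>\<phi>\<close> and \<open>\<psi>\<close>, which is a complement.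
\<close>

lemma reflection_product_rotation:
  fixes e f :: "'v::real_vector" and \<theta> :: real and m :: nat
  assumes lin: "linear \<phi>" "linear \<psi>"
    and val: "\<phi> e = 1" "\<psi> f = 1" "\<phi> f = - cos \<theta>" "\<psi> e = - cos \<theta>"
    and \<theta>: "sin \<theta> \<noteq> 0" "sin (2 * m * \<theta>) = 0" "cos (2 * m * \<theta>) = 1"
  shows "((reflection \<phi> e \<circ> reflection \<psi> f) ^^ m) x = x"
proof -
  let ?g = "reflection \<phi> e \<circ> reflection \<psi> f"
  \<comment> \<open>These two recurrences match the rows of the matrix of \<open>?g\<close> with
    respect to \<open>e\<close> and \<open>f\<close>, computed in \<open>step\<close>.\<close>
  have sin3: "sin (b + 2 * \<theta>) = (4 * (cos \<theta>)\<^sup>2 - 1) * sin b - 2 * cos \<theta> * sin (b - \<theta>)" for b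
    unfolding sin_add sin_diff sin_double cos_double_cos
    by (simp add: algebra_simps power2_eq_square)
  have sin2: "sin (b + \<theta>) = 2 * cos \<theta> * sin b - sin (b - \<theta>)" for b
    by (simp add: sin_add sin_diff algebra_simps)
  note lins = linear_add[OF lin(1)] linear_add[OF lin(2)] linear_diff[OF lin(1)] linear_diff[OF lin(2)]
    linear_cmul[OF lin(1)] linear_cmul[OF lin(2)]
  have g: "linear ?g" by (intro linear_compose linear_reflection lin)
  have step: "?g (a *\<^sub>R e + b *\<^sub>R f) =
      ((4 * (cos \<theta>)\<^sup>2 - 1) * a - 2 * cos \<theta> * b) *\<^sub>R e + (2 * cos \<theta> * a - b) *\<^sub>R f" for a b
  proof -
    have "reflection \<psi> f (a *\<^sub>R e + b *\<^sub>R f) = a *\<^sub>R e + (2 * cos \<theta> * a - b) *\<^sub>R f"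
      using reflection_on_plane[OF lin(2) val(2), of b a e] by (simp add: val add.commute mult_ac)
    moreover have "- a - 2 * (2 * cos \<theta> * a - b) * \<phi> f = (4 * (cos \<theta>)\<^sup>2 - 1) * a - 2 * cos \<theta> * b"
      by (simp add: val algebra_simps power2_eq_square)
    ultimately show ?thesis by (simp only: comp_apply reflection_on_plane[OF lin(1) val(1)])
  qed
  \<comment> \<open>Starting from \<open>e\<close> and \<open>f\<close> scaled by sin \<theta> makes
    the coefficients plain sines; the factor is cancelled once n = m.\<close>
  have ge: "(?g ^^ n) (sin \<theta> *\<^sub>R e) = sin (2 * real n * \<theta> + \<theta>) *\<^sub>R e + sin (2 * real n * \<theta>) *\<^sub>R f" for n
  proof (induction n)
    case (Suc n)
    have "sin (2 * real (Suc n) * \<theta> + \<theta>) = (4 * (cos \<theta>)\<^sup>2 - 1) * sin (2 * real n * \<theta> + \<theta>) - 2 * cos \<theta> * sin (2 * real n * \<theta>)"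
      "sin (2 * real (Suc n) * \<theta>) = 2 * cos \<theta> * sin (2 * real n * \<theta> + \<theta>) - sin (2 * real n * \<theta>)"
      using sin3[of "2 * real n * \<theta> + \<theta>"] sin2[of "2 * real n * \<theta> + \<theta>"] by (simp_all add: algebra_simps)
    then show ?case by (simp only: funpow.simps comp_apply[of ?g] Suc step)
  qed simp
  have gf: "(?g ^^ n) (sin \<theta> *\<^sub>R f) = - sin (2 * real n * \<theta>) *\<^sub>R e - sin (2 * real n * \<theta> - \<theta>) *\<^sub>R f" for n
  proof (induction n)
    case (Suc n)
    have "?g (- sin (2 * real n * \<theta>) *\<^sub>R e - sin (2 * real n * \<theta> - \<theta>) *\<^sub>R f) =
        ((4 * (cos \<theta>)\<^sup>2 - 1) * (- sin (2 * real n * \<theta>)) - 2 * cos \<theta> * (- sin (2 * real n * \<theta> - \<theta>))) *\<^sub>R e +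
        (2 * cos \<theta> * (- sin (2 * real n * \<theta>)) - (- sin (2 * real n * \<theta> - \<theta>))) *\<^sub>R f"
      using step[of "- sin (2 * real n * \<theta>)" "- sin (2 * real n * \<theta> - \<theta>)"] by simp
    moreover have "(4 * (cos \<theta>)\<^sup>2 - 1) * (- sin (2 * real n * \<theta>)) - 2 * cos \<theta> * (- sin (2 * real n * \<theta> - \<theta>)) =
        - sin (2 * real (Suc n) * \<theta>)"
      "2 * cos \<theta> * (- sin (2 * real n * \<theta>)) - (- sin (2 * real n * \<theta> - \<theta>)) = - sin (2 * real (Suc n) * \<theta> - \<theta>)"
      using sin3[of "2 * real n * \<theta>"] sin2[of "2 * real n * \<theta>"] by (simp_all add: algebra_simps)
    ultimately show ?case by (simp only: funpow.simps comp_apply[of ?g] Suc) simp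
  qed simp
  have gm: "linear (?g ^^ m)" using linear_funpow[OF g] .
  have "sin \<theta> *\<^sub>R (?g ^^ m) e = sin \<theta> *\<^sub>R e" "sin \<theta> *\<^sub>R (?g ^^ m) f = sin \<theta> *\<^sub>R f"
    using ge[of m] gf[of m] \<theta>(2,3) unfolding linear_cmul[OF gm] by (simp_all add: sin_add sin_diff)
  then have gmef: "(?g ^^ m) e = e" "(?g ^^ m) f = f" using \<theta>(1) by simp_all
  \<comment> \<open>The solution of the 2x2 system that puts \<open>y\<close> into both kernels; its
    determinant is the square of sin \<theta>.\<close>
  define a where "a = - (\<phi> x + cos \<theta> * \<psi> x) / (sin \<theta>)\<^sup>2"
  define b where "b = - (\<psi> x + cos \<theta> * \<phi> x) / (sin \<theta>)\<^sup>2"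
  define y where "y = x + a *\<^sub>R e + b *\<^sub>R f"
  have s: "(sin \<theta>)\<^sup>2 = 1 - (cos \<theta>)\<^sup>2" by (simp add: sin_squared_eq)
  have "(sin \<theta>)\<^sup>2 \<noteq> 0" using \<theta>(1) by simp
  then have ab: "(sin \<theta>)\<^sup>2 * a = - (\<phi> x + cos \<theta> * \<psi> x)" "(sin \<theta>)\<^sup>2 * b = - (\<psi> x + cos \<theta> * \<phi> x)"
    by (simp_all add: a_def b_def)
  have "(sin \<theta>)\<^sup>2 * \<phi> y = (sin \<theta>)\<^sup>2 * \<phi> x + (sin \<theta>)\<^sup>2 * a - cos \<theta> * ((sin \<theta>)\<^sup>2 * b)"
    by (simp add: y_def lins val algebra_simps)
  also have "\<dots> = 0" unfolding ab unfolding s by (simp add: algebra_simps power2_eq_square)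
  finally have "\<phi> y = 0" using \<theta>(1) by simp
  have "(sin \<theta>)\<^sup>2 * \<psi> y = (sin \<theta>)\<^sup>2 * \<psi> x - cos \<theta> * ((sin \<theta>)\<^sup>2 * a) + (sin \<theta>)\<^sup>2 * b"
    by (simp add: y_def lins val algebra_simps)
  also have "\<dots> = 0" unfolding ab unfolding s by (simp add: algebra_simps power2_eq_square)
  finally have "\<psi> y = 0" using \<theta>(1) by simp
  have "?g y = y" using \<open>\<phi> y = 0\<close> \<open>\<psi> y = 0\<close> by (simp add: reflection_def)
  then have "(?g ^^ m) y = y" by (induction m) simp_all
  moreover have "x = y - a *\<^sub>R e - b *\<^sub>R f" by (simp add: y_def)
  ultimately show ?thesis
    using gmef by (simp add: linear_diff[OF gm] linear_cmul[OF gm])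
qed

text \<open>For d >= 1 the product is not a rotation of the plane of \<open>e\<close> and
  \<open>f\<close>: the orbit of \<open>e\<close> enters the negative cone and its coefficients keep
  growing, so it never returns.\<close>

lemma reflection_product_infinite_order:
  fixes e f :: "'v::real_vector"
  assumes lin: "linear \<phi>" "linear \<psi>"
    and val: "\<phi> e = 1" "\<psi> f = 1" "\<phi> f = - d" "\<psi> e = - d" "1 \<le> d"
    and ind: "\<And>u. f \<noteq> u *\<^sub>R e" and n: "0 < n"
  shows "((reflection \<psi> f \<circ> reflection \<phi> e) ^^ n) e \<noteq> e"
proof -
  let ?g = "reflection \<psi> f \<circ> reflection \<phi> e"
  have step: "?g (- a *\<^sub>R e - b *\<^sub>R f) = - (2 * d * b - a) *\<^sub>R e - (2 * d * (2 * d * b - a) - b) *\<^sub>R f" for a b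
  proof -
    have "reflection \<phi> e (- a *\<^sub>R e - b *\<^sub>R f) = - (2 * d * b - a) *\<^sub>R e - b *\<^sub>R f"
      using reflection_on_plane[OF lin(1) val(1), of "- a" "- b" f] by (simp add: val mult_ac)
    moreover have "- (- b) - 2 * (- (2 * d * b - a)) * \<psi> e = - (2 * d * (2 * d * b - a) - b)"
      by (simp add: val algebra_simps)
    then have "reflection \<psi> f (- (2 * d * b - a) *\<^sub>R e - b *\<^sub>R f) =
        - (2 * d * b - a) *\<^sub>R e - (2 * d * (2 * d * b - a) - b) *\<^sub>R f"
      using reflection_on_plane[OF lin(2) val(2), of "- b" "- (2 * d * b - a)" e]
      by (simp only:) (simp only: scaleR_minus_left diff_conv_add_uminus add.commute)
    ultimately show ?thesis by (simp only: comp_apply)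
  qed
  \<comment> \<open>The condition 1 <= a < b is preserved: a' = 2db - a exceeds b, and then b' =
    2da' - b exceeds a'.\<close>
  have "\<exists>a b. (?g ^^ Suc m) e = - a *\<^sub>R e - b *\<^sub>R f \<and> 1 \<le> a \<and> a < b" for m
  proof (induction m)
    case 0
    have "?g e = - 1 *\<^sub>R e - (2 * d) *\<^sub>R f"
      using step[of "-1" 0] by simp
    then show ?case using val(5) by (intro exI[of _ 1] exI[of _ "2 * d"]) simp
  next
    case (Suc m)
    then obtain a b where ab: "(?g ^^ Suc m) e = - a *\<^sub>R e - b *\<^sub>R f" "1 \<le> a" "a < b" by blast
    define a' where "a' = 2 * d * b - a"
    have "1 * b \<le> d * b" using val(5) ab by (intro mult_right_mono) auto
    then have a': "b < a'" using ab(3) by (simp add: a'_def)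
    have "1 * a' \<le> d * a'" using val(5) ab a' by (intro mult_right_mono) auto
    then have "a' < 2 * d * a' - b" using a' by simp
    moreover have "(?g ^^ Suc (Suc m)) e = - a' *\<^sub>R e - (2 * d * a' - b) *\<^sub>R f"
      unfolding funpow.simps(2)[of "Suc m"] comp_apply[of ?g] ab(1) step a'_def ..
    moreover have "1 \<le> a'" using a' ab by linarith
    ultimately show ?case by blast
  qed
  then obtain a b where ab: "(?g ^^ n) e = - a *\<^sub>R e - b *\<^sub>R f" "1 \<le> a" "a < b"
    using gr0_implies_Suc[OF n] by metis
  show ?thesis
  proof
    assume "(?g ^^ n) e = e"
    \<comment> \<open>A return to \<open>e\<close> would make \<open>f\<close> a multiple of
      \<open>e\<close>, because b is nonzero.\<close>
    have "b *\<^sub>R f = - a *\<^sub>R e - (- a *\<^sub>R e - b *\<^sub>R f)" by simp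
    also have "\<dots> = - a *\<^sub>R e - e" unfolding ab(1)[symmetric] \<open>(?g ^^ n) e = e\<close> ..
    also have "\<dots> = (- (a + 1)) *\<^sub>R e" by (simp add: algebra_simps)
    finally have "b *\<^sub>R f = (- (a + 1)) *\<^sub>R e" .
    then have "(1 / b) *\<^sub>R (b *\<^sub>R f) = (1 / b) *\<^sub>R ((- (a + 1)) *\<^sub>R e)" by simp
    then have "f = (1 / b * - (a + 1)) *\<^sub>R e" using ab by (simp only: scaleR_scaleR) simp
    then show False using ind by blast
  qed
qed

text \<open>
  The inner product with the \<open>k\<close>-th root; the roots \<open>k - 1\<close> and \<open>k + 1\<close> have inner product \<open>- r k\<close>.
\<close>

definition root_form :: "(3 \<Rightarrow> real) \<Rightarrow> 3 \<Rightarrow> real^3 \<Rightarrow> real" where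
  "root_form r k x = x $ k - r (k + 1) * x $ (k - 1) - r (k - 1) * x $ (k + 1)"

definition coxeter_reflection :: "(3 \<Rightarrow> real) \<Rightarrow> 3 \<Rightarrow> real^3 \<Rightarrow> real^3" where
  "coxeter_reflection r k = reflection (root_form r k) (axis k 1)"

lemma index_3_eq: "(0::3) = 3" "(4::3) = 1"
  by simp_all

lemma linear_root_form: "linear (root_form r k)"
  by (rule linearI) (simp_all add: root_form_def algebra_simps)

lemma root_form_axis:
  "root_form r k (axis k 1) = 1"
  "root_form r (k - 1) (axis (k + 1) 1) = - r k"
  "root_form r (k + 1) (axis (k - 1) 1) = - r k"
proof -
  have "\<forall>k. root_form r k (axis k 1) = 1 \<and> root_form r (k - 1) (axis (k + 1) 1) = - r k \<and>
     root_form r (k + 1) (axis (k - 1) 1) = - r k"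
    unfolding forall_3 by (simp add: root_form_def axis_def)
  then show "root_form r k (axis k 1) = 1"
  "root_form r (k - 1) (axis (k + 1) 1) = - r k"
  "root_form r (k + 1) (axis (k - 1) 1) = - r k" by blast+
qed

lemma coxeter_reflection_involution: "coxeter_reflection r k (coxeter_reflection r k x) = x"
  unfolding coxeter_reflection_def by (intro reflection_involution linear_root_form root_form_axis)

text \<open>The geometric representation respects the relators: for finite \<open>p k\<close> = m
  the roots k - 1 and k + 1 have inner product -cos(pi/m), so their reflections compose to a
  rotation of order m. An infinite \<open>p k\<close> contributes no such relator.\<close>

lemma coxeter_reflection_relator:
  assumes "\<And>k. 3 \<le> p k" "\<And>k. r k = cos (triangle_angle (p k))" "w \<in> triangle_relators p"
  shows "foldr (\<lambda>a. coxeter_reflection r (fst a)) w x = x"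
proof -
  consider k where "w = [(k, True), (k, True)]"
    | k m where "p k = enat m" "w = concat (replicate m [(k - 1, True), (k + 1, True)])"
    using assms(3) unfolding triangle_relators_def by blast
  then show ?thesis
  proof cases
    case 1
    then show ?thesis by (simp add: coxeter_reflection_involution)
  next
    case 2
    have m: "3 \<le> m" using assms(1)[of k] 2(1) by (simp add: numeral_eq_enat)
    then have rk: "r k = cos (pi / m)" using assms(2)[of k] 2(1) by (simp add: triangle_angle_def)
    have "0 < sin (pi / m)" using m by (intro sin_gt_zero) (auto simp: field_simps)
    moreover have "2 * m * (pi / m) = 2 * pi" using m by simp
    ultimately have "((reflection (root_form r (k - 1)) (axis (k - 1) 1) \<circ>
        reflection (root_form r (k + 1)) (axis (k + 1) 1)) ^^ m) x = x"
      by (intro reflection_product_rotation[where \<theta> = "pi / m"] linear_root_form)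
        (simp_all add: root_form_axis rk)
    then show ?thesis
      by (simp add: 2(2) foldr_concat_replicate comp_def coxeter_reflection_def)
  qed
qed

text \<open>The bound yields \<open>r 3 + 2 * r 1 * r 2\<close> >= 1/2 + 2/4 = 1, the threshold for
  infinite order.\<close>

lemma triangle_angle_cos_ge_half:
  assumes "3 \<le> n" shows "1 / 2 \<le> cos (triangle_angle n)"
proof (cases n)
  case (enat m)
  with assms have "3 \<le> m" by (simp add: numeral_eq_enat)
  then have "cos (pi / 3) \<le> cos (pi / m)"
    by (intro cos_monotone_0_pi_le) (auto simp: field_simps)
  then show ?thesis by (simp add: enat triangle_angle_def cos_60)
qed (simp add: triangle_angle_def)

lemma triangle_group_infinite_order:
  assumes p: "\<And>k. 3 \<le> p k" and n: "0 < n"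
  shows "\<not> pres_eq (triangle_relators p)
    (concat (replicate n [(3, True), (2, True), (3, True), (1, True)])) []"
proof
  define r where "r k = cos (triangle_angle (p k))" for k
  let ?s = "coxeter_reflection r"
  \<comment> \<open>The root and the linear form of the conjugated reflection s_3 s_2 s_3;
    explicitly \<open>?f\<close> is e_2 + 2 r_1 e_3.\<close>
  let ?f = "?s 3 (axis 2 1)" and ?\<psi> = "\<lambda>x. root_form r 2 (?s 3 x)"
  assume "pres_eq (triangle_relators p)
    (concat (replicate n [(3, True), (2, True), (3, True), (1, True)])) []"
  then have "(foldr (\<lambda>a. ?s (fst a)) [(3, True), (2, True), (3, True), (1, True)] ^^ n) =
      foldr (\<lambda>a. ?s (fst a)) ([] :: 3 gword)"
    unfolding foldr_concat_replicate[symmetric]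
    by (rule pres_eq_action[where s = ?s]) (simp_all add: coxeter_reflection_involution
        coxeter_reflection_relator[OF p r_def])
  then have "((?s 3 \<circ> ?s 2 \<circ> ?s 3 \<circ> ?s 1) ^^ n) (axis 1 1) = axis 1 1"
    by (simp add: comp_def)
  moreover have lin: "linear (?s k)" for k
    unfolding coxeter_reflection_def by (intro linear_reflection linear_root_form)
  have "?s 3 (?s 2 (?s 3 x)) = reflection ?\<psi> ?f x" for x
    by (simp add: coxeter_reflection_def[of _ 2] reflection_def linear_diff[OF lin] linear_cmul[OF lin]
        coxeter_reflection_involution)
  then have "?s 3 \<circ> ?s 2 \<circ> ?s 3 = reflection ?\<psi> ?f" by (simp add: fun_eq_iff)
  ultimately have "((reflection ?\<psi> ?f \<circ> reflection (root_form r 1) (axis 1 1)) ^^ n) (axis 1 1) = axis 1 1"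
    by (simp add: coxeter_reflection_def[of _ 1])
  moreover have "((reflection ?\<psi> ?f \<circ> reflection (root_form r 1) (axis 1 1)) ^^ n) (axis 1 1) \<noteq> axis 1 1"
  proof (rule reflection_product_infinite_order[where d = "r 3 + 2 * r 1 * r 2"])
    show "linear (root_form r 1)" by (rule linear_root_form)
    show "linear ?\<psi>" using linear_compose[OF lin linear_root_form] by (simp add: comp_def)
    show "root_form r 1 (axis 1 1) = 1" by (rule root_form_axis)
    show "?\<psi> ?f = 1" by (simp add: coxeter_reflection_involution root_form_axis)
    show "root_form r 1 ?f = - (r 3 + 2 * r 1 * r 2)" "?\<psi> (axis 1 1) = - (r 3 + 2 * r 1 * r 2)"
      by (simp_all add: coxeter_reflection_def reflection_def root_form_def axis_def index_3_eq algebra_simps)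
    have half: "1 / 2 \<le> r k" for k using triangle_angle_cos_ge_half[OF p] by (simp add: r_def)
    have "(1 / 2) * (1 / 2) \<le> r 1 * r 2" using half[of 1] half[of 2] by (intro mult_mono) auto
    then show "1 \<le> r 3 + 2 * r 1 * r 2" using half[of 3] by simp
    show "?f \<noteq> u *\<^sub>R axis 1 1" for u
    proof
      assume "?f = u *\<^sub>R axis 1 1"
      then have "?f $ 2 = (u *\<^sub>R axis 1 1 :: real^3) $ 2" by simp
      then show False by (simp add: coxeter_reflection_def reflection_def axis_def)
    qed
  qed (rule n)
  ultimately show False by blast
qed

subsection \<open>Triangles\<close>

lemma matrix_mult_U21:
  "A \<in> carrier U21 \<Longrightarrow> B \<in> carrier U21 \<Longrightarrow> A ** B \<in> carrier U21"
  using monoid.m_closed[OF group.is_monoid[OF group_U21], of A B] by (simp add: U21_def)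

text \<open>Words in the generators without inverses suffice here, and on these the homomorphism
  property determines the image.\<close>

lemma triangle_rep_word:
  assumes "triangle_rep p c \<rho>" "\<And>k. normalised_polar (c k)"
  defines "M \<equiv> \<lambda>w. foldr (\<lambda>k A. complex_reflection (c k) ** A) w (mat 1)"
  shows "\<rho> (pres_class (triangle_relators p) (map (\<lambda>k. (k, True)) w)) = PU_class (M w)"
    and "M w \<in> carrier U21"
proof -
  interpret PU21: group PU21 by (rule group_PU21)
  let ?cls = "pres_class (triangle_relators p)"
  have hom: "\<rho> \<in> hom (triangle_group p) PU21" using assms(1) by (simp add: triangle_rep_def)
  have carrier: "?cls u \<in> carrier (triangle_group p)" for u
    by (simp add: triangle_group_def presented_group_def)
  have mult: "\<rho> (?cls (u @ v)) = \<rho> (?cls u) \<otimes>\<^bsub>PU21\<^esub> \<rho> (?cls v)" for u v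
    using hom_mult[OF hom carrier carrier, of u v]
    by (simp add: triangle_group_def presented_group_mult)
  have closed: "\<rho> (?cls u) \<in> carrier PU21" for u by (rule hom_in_carrier[OF hom carrier])
  have M: "M w \<in> carrier U21" for w
  proof (induction w)
    case Nil
    show ?case by (simp add: M_def U21_def)
  next
    case (Cons k w)
    then show ?case
      using matrix_mult_U21[OF complex_reflection_in_U21[OF assms(2)]] by (simp add: M_def)
  qed
  then show "M w \<in> carrier U21" .
  show "\<rho> (?cls (map (\<lambda>k. (k, True)) w)) = PU_class (M w)"
  proof (induction w)
    case Nil
    \<comment> \<open>The image of the empty word is idempotent in a group, hence the
      identity.\<close>
    have "\<rho> (?cls []) = \<one>\<^bsub>PU21\<^esub>"
      using mult[of "[]" "[]"] closed[of "[]"] PU21.l_cancel_one' by simp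
    then show ?case by (simp add: M_def one_PU21)
  next
    case (Cons k w)
    have "\<rho> (?cls [(k, True)]) = PU_class (complex_reflection (c k))"
      using assms(1) by (simp add: triangle_rep_def triangle_gen_def)
    then show ?case
      using mult[of "[(k, True)]" "map (\<lambda>k. (k, True)) w"] Cons
        PU_class_mult[OF complex_reflection_in_U21[OF assms(2)] M]
      by (simp add: M_def)
  qed
qed

lemma cos_angular_invariant:
  assumes "has_parameter c t"
  shows "cos (angular_invariant c) = (t\<^sup>2 - 1) / (t\<^sup>2 + 1)"
proof -
  define \<beta> where "\<beta> = angular_invariant c / 2"
  have "angular_invariant c \<noteq> 0" "t = cot \<beta>"
    using assms by (simp_all add: has_parameter_def \<beta>_def)
  moreover have "- pi < angular_invariant c" "angular_invariant c \<le> pi"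
    unfolding angular_invariant_def using Arg_bounded by auto
  \<comment> \<open>Half of a nonzero angle in (-pi, pi] is not a zero of the sine, so the default
    value of \<open>cot\<close> at such zeros does not interfere.\<close>
  ultimately have "sin \<beta> \<noteq> 0"
    using sin_gt_zero[of \<beta>] sin_gt_zero[of "- \<beta>"] by (cases "\<beta> > 0") (auto simp: \<beta>_def)
  then have "t * sin \<beta> = cos \<beta>" using \<open>t = cot \<beta>\<close> by (simp add: cot_def)
  then have "(cos \<beta>)\<^sup>2 = t\<^sup>2 * (sin \<beta>)\<^sup>2" by (metis power_mult_distrib)
  moreover have "(sin \<beta>)\<^sup>2 + (cos \<beta>)\<^sup>2 = 1" by simp
  ultimately have "(t\<^sup>2 + 1) * (sin \<beta>)\<^sup>2 = 1" "(t\<^sup>2 + 1) * (cos \<beta>)\<^sup>2 = t\<^sup>2"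
    by algebra+
  then have "(t\<^sup>2 + 1) * cos (2 * \<beta>) = t\<^sup>2 - 1"
    unfolding cos_double by (simp add: algebra_simps)
  moreover have "t\<^sup>2 + 1 \<noteq> 0" by (metis add_nonneg_eq_0_iff zero_le_power2 zero_le_one zero_neq_one)
  ultimately show ?thesis by (simp add: \<beta>_def field_simps)
qed

text \<open>For -1 <= x < 1, \<open>threshold\<close> inverts t -> (t^2 - 1)/(t^2 + 1) on t >= 0.
  Below -1 the bound is automatic, and x >= 1 would make the threshold infinite.\<close>

lemma threshold_less:
  assumes "threshold x < ereal \<bar>t\<bar>"
  shows "x < (t\<^sup>2 - 1) / (t\<^sup>2 + 1)"
proof -
  have pos: "0 < t\<^sup>2 + 1" by (intro add_nonneg_pos) auto
  consider "x < -1" | "- 1 \<le> x" "x < 1" using assms by (fastforce simp: threshold_def split: if_splits)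
  then show ?thesis
  proof cases
    case 1
    have "- 1 * (t\<^sup>2 + 1) \<le> t\<^sup>2 - 1" by simp
    moreover have "x * (t\<^sup>2 + 1) < - 1 * (t\<^sup>2 + 1)" using 1 pos by (intro mult_strict_right_mono) auto
    ultimately show ?thesis using pos by (subst pos_less_divide_eq) linarith+
  next
    case 2
    then have "sqrt ((1 + x) / (1 - x)) < \<bar>t\<bar>" using assms by (simp add: threshold_def)
    then have "(1 + x) / (1 - x) < t\<^sup>2"
      using real_sqrt_less_iff[of "(1 + x) / (1 - x)" "t\<^sup>2"] by simp
    then show ?thesis using 2 pos by (simp add: field_simps)
  qed
qed

lemma triangle_pairing:
  assumes "is_triangle p c" "\<And>k. r k = cos (triangle_angle (p k))"
  shows "cmod (herm (c 3) (c 2)) = r 1" "cmod (herm (c 1) (c 3)) = r 2" "cmod (herm (c 2) (c 1)) = r 3"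
proof -
  have "cmod (herm (c (k - 1)) (c (k + 1))) = r k" for k
    using assms unfolding is_triangle_def meet_at_angle_def by auto
  from this[of 1] this[of 2] this[of 3]
  show "cmod (herm (c 3) (c 2)) = r 1" "cmod (herm (c 1) (c 3)) = r 2" "cmod (herm (c 2) (c 1)) = r 3"
    by (simp_all add: index_3_eq)
qed

text \<open>The pairing is 2<c_2,c_3><c_3,c_1> - <c_2,c_1>; the cross term of its squared modulus is
  the real part of the triple product whose argument is the angular invariant.\<close>

lemma reflected_pairing:
  assumes "is_triangle p c" "\<And>k. r k = cos (triangle_angle (p k))"
  shows "(cmod (herm (complex_reflection (c 3) *v c 2) (c 1)))\<^sup>2 =
    4 * (r 1)\<^sup>2 * (r 2)\<^sup>2 + (r 3)\<^sup>2 - 4 * r 1 * r 2 * r 3 * cos (angular_invariant c)"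
proof -
  define x y z where "x = herm (c 3) (c 2)" and "y = herm (c 1) (c 3)" and "z = herm (c 2) (c 1)"
  have r: "cmod x = r 1" "cmod y = r 2" "cmod z = r 3"
    using triangle_pairing[OF assms] by (simp_all add: x_def y_def z_def)
  have cnj: "herm (c 2) (c 3) = cnj x" "herm (c 3) (c 1) = cnj y"
    by (simp_all add: x_def y_def cnj_herm)
  have "(\<Prod>k\<in>UNIV. h k) = h 1 * h 2 * h 3" for h :: "3 \<Rightarrow> complex"
    unfolding UNIV_3 by (simp add: mult.assoc)
  then have "(\<Prod>k\<in>UNIV. herm (c (k - 1)) (c (k + 1))) = x * y * z"
    by (simp add: x_def y_def z_def index_3_eq)
  then have "angular_invariant c = Arg (x * y * z)" by (simp add: angular_invariant_def)
  moreover have "Re w = cmod w * cos (Arg w)" for w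
    by (cases "w = 0") (simp_all add: cos_Arg)
  ultimately have "Re (x * y * z) = r 1 * r 2 * r 3 * cos (angular_invariant c)"
    by (metis norm_mult r)
  moreover have "herm (complex_reflection (c 3) *v c 2) (c 1) = 2 * cnj (x * y) - z"
    by (simp add: complex_reflection_apply herm_simps cnj z_def[symmetric])
  moreover have "(cmod (2 * cnj w - z))\<^sup>2 = 4 * (cmod w)\<^sup>2 + (cmod z)\<^sup>2 - 4 * Re (w * z)" for w z
    unfolding cmod_power2 by (simp add: power2_eq_square algebra_simps)
  moreover have "(cmod (x * y))\<^sup>2 = (r 1)\<^sup>2 * (r 2)\<^sup>2"
    by (simp add: r norm_mult power_mult_distrib)
  ultimately show ?thesis by (simp only: r mult.assoc)
qed

theorem corollary13:
  fixes p :: "3 \<Rightarrow> enat" and r :: "3 \<Rightarrow> real" and c :: "3 \<Rightarrow> complex^3"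
    and \<rho> :: "3 gword set \<Rightarrow> (complex^3^3) set"
    and t c_inf c_A :: real and t_inf t_A :: ereal
  assumes p: "\<And>k. p k \<ge> 3"
    and r: "\<And>k. r k = cos (triangle_angle (p k))"
    and c_inf: "c_inf = ((r 1)\<^sup>2 + (r 2)\<^sup>2 + (r 3)\<^sup>2 - 1) / (2 * r 1 * r 2 * r 3)"
    and t_inf: "t_inf = threshold c_inf"
    and c_A: "c_A = (4 * (r 1)\<^sup>2 * (r 2)\<^sup>2 + (r 3)\<^sup>2 - 1) / (4 * r 1 * r 2 * r 3)"
    and t_A: "t_A = threshold c_A"
    and triangle: "is_triangle p c"
    and param: "has_parameter c t"
    and t_range: "ereal t \<in> {- t_inf<..<t_inf}"
    and t_large: "ereal \<bar>t\<bar> > t_A"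
    and rep: "triangle_rep p c \<rho>"
  shows "regular_elliptic (PU_class
           (complex_reflection (c 3) ** complex_reflection (c 2) **
            complex_reflection (c 3) ** complex_reflection (c 1)))
       \<and> \<not> discrete_embedding p \<rho>"
proof -
  let ?R = "\<lambda>k. complex_reflection (c k)"
  define a where "a = ?R 3 *v c 2"
  define W where "W = ?R 3 ** ?R 2 ** ?R 3 ** ?R 1"
  have polar: "normalised_polar (c k)" for k using triangle by (simp add: is_triangle_def)
  note U = complex_reflection_in_U21[OF polar]
  have W_U21: "W \<in> carrier U21" unfolding W_def by (intro matrix_mult_U21 U)
  have W: "W = complex_reflection a ** ?R 1"
    by (simp add: W_def a_def complex_reflection_conjugate[OF polar])

  have aa: "herm a a = 1"
    using U[of 3] polar[of 2] by (simp add: a_def U21_def normalised_polar_def)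
  have bb: "herm (c 1) (c 1) = 1" using polar by (simp add: normalised_polar_def)
  let ?\<kappa> = "cos (angular_invariant c)"
  have \<kappa>: "?\<kappa> = (t\<^sup>2 - 1) / (t\<^sup>2 + 1)" by (rule cos_angular_invariant[OF param])
  have half: "1 / 2 \<le> r k" for k using triangle_angle_cos_ge_half[OF p] by (simp add: r)
  have rpos: "0 < r k" for k using half[of k] by linarith
  have P: "0 < 4 * r 1 * r 2 * r 3" using rpos by simp
  have sq: "(cmod (herm a (c 1)))\<^sup>2 = 4 * (r 1)\<^sup>2 * (r 2)\<^sup>2 + (r 3)\<^sup>2 - 4 * r 1 * r 2 * r 3 * ?\<kappa>"
    unfolding a_def by (rule reflected_pairing[OF triangle r])
  \<comment> \<open>Clearing the positive denominator of \<open>c_A\<close> turns this into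
    |<a,c_1>| < 1: the geodesics polar to \<open>a\<close> and \<open>c 1\<close> meet inside the
    complex hyperbolic plane.\<close>
  have "c_A < ?\<kappa>" unfolding \<kappa> using t_large t_A by (intro threshold_less) simp
  then have "4 * (r 1)\<^sup>2 * (r 2)\<^sup>2 + (r 3)\<^sup>2 - 1 < 4 * r 1 * r 2 * r 3 * ?\<kappa>"
    unfolding c_A using P by (simp add: pos_divide_less_eq mult.commute)
  then have "(cmod (herm a (c 1)))\<^sup>2 < 1" using sq by linarith
  then have lt1: "cmod (herm a (c 1)) < 1" by (simp add: abs_square_less_1)
  have "0 < t\<^sup>2 + 1" by (intro add_nonneg_pos) auto
  then have "?\<kappa> < 1" by (simp add: \<kappa>)
  \<comment> \<open>Since cos \<alpha> < 1, the squared pairing exceeds (2 r_1 r_2 - r_3)^2. A zero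
    pairing would give the double eigenvalue -1.\<close>
  then have "4 * r 1 * r 2 * r 3 * ?\<kappa> < 4 * r 1 * r 2 * r 3 * 1"
    using P by (intro mult_strict_left_mono)
  moreover have "(2 * r 1 * r 2 - r 3)\<^sup>2 = 4 * (r 1)\<^sup>2 * (r 2)\<^sup>2 + (r 3)\<^sup>2 - 4 * r 1 * r 2 * r 3"
    by (simp add: power2_eq_square algebra_simps)
  moreover have "0 \<le> (2 * r 1 * r 2 - r 3)\<^sup>2" by simp
  ultimately have "(cmod (herm a (c 1)))\<^sup>2 > 0" using sq by linarith
  then have nz: "herm a (c 1) \<noteq> 0" by auto

  obtain n v w \<mu> where eig: "Re (herm n n) < 0" "v \<noteq> 0" "w \<noteq> 0"
    "W *v n = n" "W *v v = \<mu> *s v" "W *v w = cnj \<mu> *s w" "cmod \<mu> = 1" "Im \<mu> \<noteq> 0"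
    using reflection_product_eigenvectors[OF aa bb nz lt1] unfolding W by blast
  define l :: "3 \<Rightarrow> complex" where "l i = (if i = 1 then 1 else if i = 2 then \<mu> else cnj \<mu>)" for i
  define e :: "3 \<Rightarrow> complex^3" where "e i = (if i = 1 then n else if i = 2 then v else w)" for i
  have "inj l"
  proof -
    have "\<mu> \<noteq> 1" "cnj \<mu> \<noteq> 1" "\<mu> \<noteq> cnj \<mu>" using eig(8) by (auto simp: complex_eq_iff)
    then show ?thesis by (auto simp: inj_def forall_3 l_def)
  qed
  moreover have "n \<noteq> 0" using eig(1) by (auto simp: herm_def)
  then have "e i \<noteq> 0" for i using eig(2,3) by (simp add: e_def)
  moreover have "W *v e i = l i *s e i" for i using eig(4-6) by (simp add: e_def l_def)
  moreover have "cmod (l i) = 1" for i using eig(7) by (simp add: l_def)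
  ultimately have diag: "inj l" "\<And>i. W *v e i = l i *s e i" "\<And>i. e i \<noteq> 0" "\<And>i. cmod (l i) = 1"
    by blast+
  have "card (eigenvalues W) = 3"
    using eigenvalues_eq_range[OF diag(1-3)] diag(1) by (simp add: card_image)
  then have "regular_elliptic (PU_class W)"
    using regular_elliptic_PU_class[OF W_U21 eig(1), of 1] eig(4) by simp

  moreover have "\<not> discrete_embedding p \<rho>"
  proof
    assume "discrete_embedding p \<rho>"
    let ?cls = "pres_class (triangle_relators p)"
    let ?H = "\<rho> ` carrier (triangle_group p)"
    define x :: "nat \<Rightarrow> 3 gword"
      where "x n = concat (replicate n [(3, True), (2, True), (3, True), (1, True)])" for n
    have inj: "inj_on \<rho> (carrier (triangle_group p))"
      and discrete: "subtopology PU21_topology ?H = discrete_topology ?H"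
      using \<open>discrete_embedding p \<rho>\<close> by (simp_all add: discrete_embedding_def)
    have cls: "?cls u \<in> carrier (triangle_group p)" for u
      by (simp add: triangle_group_def presented_group_def)
    have \<rho>x: "\<rho> (?cls (x n)) = PU_class (W [^]\<^bsub>U21\<^esub> n)" for n
    proof -
      let ?u = "concat (replicate n [3, 2, 3, 1 :: 3])"
      have "x n = map (\<lambda>k. (k, True)) ?u" by (simp add: x_def map_concat)
      moreover have "foldr (\<lambda>k A. ?R k ** A) ?u (mat 1) = W [^]\<^bsub>U21\<^esub> n"
      proof (induction n)
        case (Suc n)
        have "W [^]\<^bsub>U21\<^esub> Suc n = W ** (W [^]\<^bsub>U21\<^esub> n)"
          using monoid.nat_pow_Suc2[OF group.is_monoid[OF group_U21] W_U21] by (simp add: U21_def)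
        then show ?case by (simp add: Suc W_def matrix_mul_assoc)
      qed (simp add: U21_def)
      ultimately show ?thesis using triangle_rep_word(1)[OF rep polar, of ?u] by simp
    qed
    \<comment> \<open>If \<mu> is a root of unity, these powers may equal the identity; this is
      covered too, as the word has infinite order and the exponents are positive.\<close>
    obtain \<nu> :: "nat \<Rightarrow> nat" where \<nu>: "\<And>k. 0 < \<nu> k" "(\<lambda>k. W [^]\<^bsub>U21\<^esub> \<nu> k) \<longlonglongrightarrow> mat 1"
      using unimodular_spectrum_recurrent[OF diag] by blast
    have one: "PU_class (mat 1) = \<rho> (?cls [])"
      using \<rho>x[of 0] by (simp add: x_def U21_def)
    have "\<forall>\<^sub>F k in sequentially. PU_class (W [^]\<^bsub>U21\<^esub> \<nu> k) = PU_class (mat 1)"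
    proof (rule discrete_subset_eventually_one[OF discrete _ _ _ \<nu>(2)])
      show "PU_class (mat 1) \<in> ?H" unfolding one using cls by blast
      show "PU_class (W [^]\<^bsub>U21\<^esub> \<nu> k) \<in> ?H" for k unfolding \<rho>x[symmetric] using cls by blast
      show "W [^]\<^bsub>U21\<^esub> \<nu> k \<in> carrier U21" for k
        using monoid.nat_pow_closed[OF group.is_monoid[OF group_U21] W_U21] .
    qed
    then obtain k where "\<rho> (?cls (x (\<nu> k))) = \<rho> (?cls [])"
      unfolding \<rho>x one[symmetric] by (auto dest: eventually_happens)
    \<comment> \<open>Injectivity pulls the coincidence back to the abstract group, where it
      contradicts infinite order.\<close>
    then have "?cls (x (\<nu> k)) = ?cls []" using inj_onD[OF inj] cls by blast
    then show False
      using triangle_group_infinite_order[of p, OF p \<nu>(1)] unfolding pres_class_eq_iff x_def by blast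
  qed
  ultimately show ?thesis unfolding W_def by blast
qed

end
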